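(* Let $0<\alpha\le 1$, $0<\tau<1$, and let $k$ be a positive integer. Given a graph $G$, applying an $\alpha$-transformation to $G$, followed by a $(\tau,k)$-transformation, yields a graph $\tilde G=T_{\tau,k}(T_\alpha(G))$ and a mapping from each community structure $\mathcal C$ of $G$ to a community structure $\tilde{\mathcal C}$ of $\tilde G$ that satisfies $$Q_{\tilde G}(\tilde{\mathcal C})=\tau\alpha\, Q_G(\mathcal C)+(1-\tau-\epsilon),\qquad\text{where }\epsilon=\frac{(1-\sqrt\tau)^2}{k}.$$
   Context: A graph $G$ on vertex set $V=\{1,\dots,n\}$ is given by a symmetric matrix $A=(A_{ij})$ with nonnegative real entries, not all zero: for $i\ne j$, $A_{ij}$ is the weight of edge $(i,j)$, and a loop of weight $w$ at $i$ contributes $2w$ to $A_{ii}$ (a loop contributes twice its weight to the degree). Set $d_i=\sum_j A_{ij}$ and $M=\frac12\sum_i d_i$. A community structure of $G$ is a partition $\mathcal C$ of $V$ into disjoint nonempty subsets with union $V$. Its modularity is $$Q_G(\mathcal C)=\frac{1}{2M}\sum_{i,j\in V}\left(A_{ij}-\frac{d_id_j}{2M}\right)\delta_{ij},$$ where $\delta_{ij}=1$ if $i,j$ are in the same part of $\mathcal C$ and $\delta_{ij}=0$ otherwise. $\alpha$-transformation ($0<\alpha\le1$): $T_\alpha(G)$ has the same vertex set $V$ and matrix $A'_{ij}=A_{ij}+\frac{1-\alpha}{\alpha}\frac{d_id_j}{2M}$ for all $i,j$; a community structure $\mathcal C$ of $G$ is mapped to the same partition of $V$, viewed as a community structure of $T_\alpha(G)$.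 $(\tau,k)$-transformation ($0<\tau<1$, $k$ a positive integer): let $\beta=\frac1{\sqrt\tau}-1$. $T_{\tau,k}(G)$ is obtained from $G$ by adding $k$ new vertices $n+1,\dots,n+k$ with no edges to other vertices, attaching to each vertex $i\in\{1,\dots,n\}$ an additional loop of weight $\frac{\beta}{2}d_i$, and attaching to each of $n+1,\dots,n+k$ a loop of weight $\frac{\beta(\beta+1)}{k}M$ (with $d_i$ and $M$ those of $G$). In matrix form: $A'_{ij}=A_{ij}$ for $1\le i\ne j\le n$; $A'_{ii}=A_{ii}+\beta d_i$ for $1\le i\le n$; $A'_{ii}=\frac{2\beta(\beta+1)}{k}M$ for $i>n$; and $A'_{ij}=0$ otherwise. A community structure $\mathcal C$ of $G$ is mapped to $\mathcal C\cup\{\{n+1\},\dots,\{n+k\}\}$. The mapping $\mathcal C\mapsto\tilde{\mathcal C}$ is the composition of these two mappings. *)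

theory Defs
  imports Complex_Main "HOL-Library.Disjoint_Sets"
begin

record wgraph =
  order :: nat
  weight :: "nat \<Rightarrow> nat \<Rightarrow> real"

definition vertices :: "wgraph \<Rightarrow> nat set" where
  "vertices G = {1..order G}"

text \<open>A loop of weight \<open>w\<close> at \<open>i\<close> contributes \<open>2 * w\<close> to the diagonal entry \<open>weight G i i\<close>.
  Entries of \<open>weight G\<close> at indices outside \<open>vertices G\<close> carry no meaning.\<close>

definition valid_graph :: "wgraph \<Rightarrow> bool" where
  "valid_graph G \<longleftrightarrow>
     (\<forall>i\<in>vertices G. \<forall>j\<in>vertices G. weight G i j = weight G j i) \<and>
     (\<forall>i\<in>vertices G. \<forall>j\<in>vertices G. 0 \<le> weight G i j) \<and>
     (\<exists>i\<in>vertices G. \<exists>j\<in>vertices G. weight G i j \<noteq> 0)"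

definition deg :: "wgraph \<Rightarrow> nat \<Rightarrow> real" where
  "deg G i = (\<Sum>j\<in>vertices G. weight G i j)"

definition total_weight :: "wgraph \<Rightarrow> real" where
  "total_weight G = 1 / 2 * (\<Sum>i\<in>vertices G. deg G i)"

definition community_structure :: "wgraph \<Rightarrow> nat set set \<Rightarrow> bool" where
  "community_structure G C \<longleftrightarrow> partition_on (vertices G) C"

definition same_part :: "nat set set \<Rightarrow> nat \<Rightarrow> nat \<Rightarrow> real" where
  "same_part C i j = (if \<exists>P\<in>C. i \<in> P \<and> j \<in> P then 1 else 0)"

definition modularity :: "wgraph \<Rightarrow> nat set set \<Rightarrow> real" where
  "modularity G C = 1 / (2 * total_weight G) *
     (\<Sum>i\<in>vertices G. \<Sum>j\<in>vertices G.
        (weight G i j - deg G i * deg G j / (2 * total_weight G)) * same_part C i j)"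

definition alpha_transform :: "real \<Rightarrow> wgraph \<Rightarrow> wgraph" where
  "alpha_transform \<alpha> G =
     \<lparr> order = order G,
       weight = (\<lambda>i j. weight G i j
                  + (1 - \<alpha>) / \<alpha> * (deg G i * deg G j / (2 * total_weight G))) \<rparr>"

definition alpha_map :: "nat set set \<Rightarrow> nat set set" where
  "alpha_map C = C"

definition tau_k_transform :: "real \<Rightarrow> nat \<Rightarrow> wgraph \<Rightarrow> wgraph" where
  "tau_k_transform \<tau> k G =
     (let n = order G; \<beta> = 1 / sqrt \<tau> - 1 in
      \<lparr> order = n + k,
        weight = (\<lambda>i j.
          if i \<in> {1..n} \<and> j \<in> {1..n} then
            (if i = j then weight G i i + \<beta> * deg G i else weight G i j)
          else if i = j \<and> i \<in> {n+1..n+k} then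
            2 * \<beta> * (\<beta> + 1) / real k * total_weight G
          else 0) \<rparr>)"

definition tau_k_map :: "nat \<Rightarrow> wgraph \<Rightarrow> nat set set \<Rightarrow> nat set set" where
  "tau_k_map k G C = C \<union> (\<lambda>v. {v}) ` {order G + 1..order G + k}"

end

theory Submission
  imports Defs
begin

text \<open>The transformation \<open>T_\<alpha>\<close> scales all degrees and the total weight by
  \<open>1 / \<alpha>\<close> and leaves every entry \<open>A_ij - d_i d_j / (2 M)\<close> of the modularity matrix unchanged,
  so it multiplies the modularity by \<open>\<alpha>\<close>.  Put \<open>s = \<beta> + 1 = 1 / sqrt \<tau>\<close>.  The transformation
  \<open>T_(\<tau>,k)\<close> scales the degrees of the old vertices by \<open>s\<close> and the total weight by
  \<open>s\<^sup>2\<close>, so the off-diagonal part of the modularity matrix is again unchanged.  The new loops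
  contribute \<open>2 M \<beta>\<close> on the old vertices and \<open>2 M \<beta> s - 2 M \<beta>\<^sup>2 / k\<close> on the new ones; dividing
  by \<open>2 M s\<^sup>2\<close> gives \<open>1 - \<tau> - \<epsilon>\<close>.\<close>

section \<open>Positivity and basic sums\<close>

lemma deg_nonneg:
  assumes "valid_graph G" "i \<in> vertices G"
  shows "0 \<le> deg G i"
  unfolding deg_def using assms by (auto simp: valid_graph_def intro: sum_nonneg)

text \<open>A nonzero entry is positive, and as all entries are nonnegative it is bounded by its row
  sum, hence by the sum of all degrees. This licenses every later division by
  \<open>2 * total_weight G\<close>.\<close>

lemma total_weight_pos:
  assumes "valid_graph G"
  shows "0 < total_weight G"
proof -
  obtain i j where ij: "i \<in> vertices G" "j \<in> vertices G" "weight G i j \<noteq> 0"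
    using assms by (auto simp: valid_graph_def)
  have "0 < weight G i j"
    using assms ij by (force simp: valid_graph_def)
  also have "weight G i j \<le> deg G i"
    unfolding deg_def using assms ij
    by (intro member_le_sum) (auto simp: valid_graph_def vertices_def)
  also have "deg G i \<le> (\<Sum>i\<in>vertices G. deg G i)"
    using assms ij by (intro member_le_sum) (auto simp: deg_nonneg vertices_def)
  finally show ?thesis
    by (simp add: total_weight_def)
qed

lemma sum_deg: "(\<Sum>i\<in>vertices G. deg G i) = 2 * total_weight G"
  by (simp add: total_weight_def)

lemma same_part_refl:
  assumes "partition_on A C" "i \<in> A"
  shows "same_part C i i = 1"
  using assms by (auto simp: same_part_def partition_on_def)

section \<open>The \<alpha>-transformation\<close>

lemma vertices_alpha_transform [simp]: "vertices (alpha_transform \<alpha> G) = vertices G"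
  by (simp add: vertices_def alpha_transform_def)

text \<open>Summing the added term over \<open>j\<close> cancels 2M, so row \<open>i\<close> gains
  (1 - \<alpha>) / \<alpha> times its own degree.\<close>

lemma deg_alpha_transform:
  assumes "\<alpha> \<noteq> 0" "total_weight G \<noteq> 0"
  shows "deg (alpha_transform \<alpha> G) i = deg G i / \<alpha>"
proof -
  have "deg (alpha_transform \<alpha> G) i =
      deg G i + (1 - \<alpha>) / \<alpha> * (deg G i * (\<Sum>j\<in>vertices G. deg G j) / (2 * total_weight G))"
    unfolding deg_def[of "alpha_transform \<alpha> G"] vertices_alpha_transform
    by (simp add: alpha_transform_def sum.distrib sum_distrib_left sum_divide_distrib
        deg_def[of G i])
  also have "\<dots> = deg G i / \<alpha>"
    using assms by (simp add: sum_deg field_simps)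
  finally show ?thesis .
qed

lemma total_weight_alpha_transform:
  assumes "\<alpha> \<noteq> 0" "total_weight G \<noteq> 0"
  shows "total_weight (alpha_transform \<alpha> G) = total_weight G / \<alpha>"
  using assms
  by (simp add: total_weight_def[of "alpha_transform \<alpha> G"] deg_alpha_transform sum_deg
      flip: sum_divide_distrib)

text \<open>The bound \<alpha> \<le> 1 makes the added symmetric term nonnegative, so entries only
  grow and a nonzero one cannot be cancelled.\<close>

lemma valid_graph_alpha_transform:
  assumes "0 < \<alpha>" "\<alpha> \<le> 1" "valid_graph G"
  shows "valid_graph (alpha_transform \<alpha> G)"
proof -
  define e where "e i j = (1 - \<alpha>) / \<alpha> * (deg G i * deg G j / (2 * total_weight G))" for i j
  have w: "weight (alpha_transform \<alpha> G) i j = weight G i j + e i j" for i j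
    by (simp add: alpha_transform_def e_def)
  have e: "0 \<le> e i j" "e i j = e j i" if "i \<in> vertices G" "j \<in> vertices G" for i j
    using that assms total_weight_pos[OF assms(3)] deg_nonneg[OF assms(3)]
    by (simp_all add: e_def mult.commute)
  obtain i j where ij: "i \<in> vertices G" "j \<in> vertices G" "weight G i j \<noteq> 0"
    using assms by (auto simp: valid_graph_def)
  have "weight G i j + e i j \<noteq> 0"
    using ij e(1)[of i j] assms(3) by (force simp: valid_graph_def)
  then show ?thesis
    using assms(3) e ij unfolding valid_graph_def w vertices_alpha_transform
    by (metis add_nonneg_nonneg)
qed

text \<open>The term d_i d_j / (2M) grows by the factor 1 / \<alpha>, and this increase is exactly
  what was added to the weight. Only the prefactor 1 / (2M) changes.\<close>

lemma modularity_alpha_transform: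
  assumes "\<alpha> \<noteq> 0" "total_weight G \<noteq> 0"
  shows "modularity (alpha_transform \<alpha> G) C = \<alpha> * modularity G C"
proof -
  have "weight (alpha_transform \<alpha> G) i j -
      deg (alpha_transform \<alpha> G) i * deg (alpha_transform \<alpha> G) j /
        (2 * total_weight (alpha_transform \<alpha> G)) =
      weight G i j - deg G i * deg G j / (2 * total_weight G)" for i j
    using assms
    by (simp add: deg_alpha_transform total_weight_alpha_transform)
      (simp add: alpha_transform_def field_simps)
  then show ?thesis
    unfolding modularity_def using assms by (simp add: total_weight_alpha_transform)
qed

section \<open>The (\<tau>,k)-transformation: degrees, total weight, validity\<close>

lemma vertices_tau_k_transform: "vertices (tau_k_transform \<tau> k G) = {1..order G + k}"
  by (simp add: vertices_def tau_k_transform_def Let_def)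

lemma sum_vertices_tau_k_transform:
  "sum f (vertices (tau_k_transform \<tau> k G)) =
    sum f (vertices G) + sum f {order G + 1..order G + k}"
  unfolding vertices_tau_k_transform unfolding vertices_def by (rule sum.ub_add_nat) simp

text \<open>The case of a new row allows any \<open>j\<close>, so only old rows need a separate case
  for new columns.\<close>

lemma weight_tau_k_transform:
  shows weight_tau_k_transform_old:
      "i \<in> vertices G \<Longrightarrow> j \<in> vertices G \<Longrightarrow> weight (tau_k_transform \<tau> k G) i j =
        weight G i j + (if i = j then (1 / sqrt \<tau> - 1) * deg G i else 0)"
    and weight_tau_k_transform_new:
      "i \<in> {order G + 1..order G + k} \<Longrightarrow> weight (tau_k_transform \<tau> k G) i j =
        (if i = j then 2 * (1 / sqrt \<tau> - 1) * (1 / sqrt \<tau>) / real k * total_weight G else 0)"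
    and weight_tau_k_transform_mixed:
      "i \<in> vertices G \<Longrightarrow> j \<in> {order G + 1..order G + k} \<Longrightarrow>
        weight (tau_k_transform \<tau> k G) i j = 0"
  by (auto simp: tau_k_transform_def Let_def vertices_def)

lemma deg_tau_k_transform_old:
  assumes "i \<in> vertices G"
  shows "deg (tau_k_transform \<tau> k G) i = deg G i / sqrt \<tau>"
proof -
  have "deg (tau_k_transform \<tau> k G) i =
      (\<Sum>j\<in>vertices G. weight G i j + (if i = j then (1 / sqrt \<tau> - 1) * deg G i else 0))"
    unfolding deg_def[of "tau_k_transform \<tau> k G"] sum_vertices_tau_k_transform
    using assms by (simp add: weight_tau_k_transform)
  also have "\<dots> = deg G i + (1 / sqrt \<tau> - 1) * deg G i"
    using assms by (simp add: sum.distrib deg_def vertices_def)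
  finally show ?thesis
    by (simp add: algebra_simps)
qed

lemma deg_tau_k_transform_new:
  assumes "i \<in> {order G + 1..order G + k}"
  shows "deg (tau_k_transform \<tau> k G) i =
    2 * (1 / sqrt \<tau> - 1) * (1 / sqrt \<tau>) / real k * total_weight G"
  using assms unfolding deg_def[of "tau_k_transform \<tau> k G"] vertices_tau_k_transform
  by (simp add: weight_tau_k_transform_new)

lemma total_weight_tau_k_transform:
  assumes "0 < \<tau>" "0 < k"
  shows "total_weight (tau_k_transform \<tau> k G) = total_weight G / \<tau>"
proof -
  have "2 * total_weight (tau_k_transform \<tau> k G) = (\<Sum>i\<in>vertices G. deg G i / sqrt \<tau>) +
      real k * (2 * (1 / sqrt \<tau> - 1) * (1 / sqrt \<tau>) / real k * total_weight G)"
    unfolding sum_deg[symmetric] sum_vertices_tau_k_transform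
    by (simp add: deg_tau_k_transform_old deg_tau_k_transform_new)
  \<comment> \<open>The factor \<open>k\<close> cancels against the \<open>k\<close> in the loop
    weight. With s = 1 / \<open>sqrt \<tau>\<close> what remains is 2M s + 2M (s - 1) s.\<close>
  also have "\<dots> = 2 * total_weight G * (1 / sqrt \<tau>)\<^sup>2"
    using assms unfolding sum_divide_distrib[symmetric] sum_deg
    by (simp add: field_simps power2_eq_square)
  also have "(1 / sqrt \<tau>)\<^sup>2 = 1 / \<tau>"
    using assms by (simp add: power_divide)
  finally show ?thesis by simp
qed

lemma valid_graph_tau_k_transform:
  assumes "0 < \<tau>" "\<tau> < 1" "valid_graph G"
  shows "valid_graph (tau_k_transform \<tau> k G)"
proof -
  define \<beta> where "\<beta> = 1 / sqrt \<tau> - 1"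
  \<comment> \<open>This is where \<tau> < 1 enters: the added loops have nonnegative
    weight.\<close>
  have \<beta>: "0 \<le> \<beta>"
    using assms by (simp add: \<beta>_def)
  have split: "i \<in> vertices (tau_k_transform \<tau> k G) \<longleftrightarrow>
      i \<in> vertices G \<or> i \<in> {order G + 1..order G + k}" for i
    unfolding vertices_tau_k_transform by (auto simp: vertices_def)
  have new: "0 \<le> 2 * \<beta> * (1 / sqrt \<tau>) / real k * total_weight G"
    using assms \<beta> total_weight_pos[OF assms(3)] by simp
  have old: "weight G i j \<le> weight (tau_k_transform \<tau> k G) i j"
    if "i \<in> vertices G" "j \<in> vertices G" for i j
    using that mult_nonneg_nonneg[OF \<beta> deg_nonneg[OF assms(3) that(1)]]
    by (auto simp: weight_tau_k_transform_old \<beta>_def)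
  have pos: "0 \<le> weight (tau_k_transform \<tau> k G) i j"
    if i: "i \<in> vertices (tau_k_transform \<tau> k G)" and j: "j \<in> vertices (tau_k_transform \<tau> k G)"
    for i j
  proof (cases "i \<in> vertices G \<and> j \<in> vertices G")
    case True
    then have "0 \<le> weight G i j"
      using assms(3) by (auto simp: valid_graph_def)
    then show ?thesis
      using old[of i j] True by linarith
  next
    case False
    then show ?thesis
      using i j new unfolding split \<beta>_def
      by (auto simp: weight_tau_k_transform_new weight_tau_k_transform_mixed
          simp del: atLeastAtMost_iff)
  qed
  \<comment> \<open>No membership of \<open>i\<close> and \<open>j\<close> is required: outside the
    old block the weight function vanishes off the diagonal.\<close>
  have sym: "weight (tau_k_transform \<tau> k G) i j = weight (tau_k_transform \<tau> k G) j i" for i j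
    using assms(3) by (auto simp: tau_k_transform_def valid_graph_def vertices_def Let_def)
  obtain i j where ij: "i \<in> vertices G" "j \<in> vertices G" "weight G i j \<noteq> 0"
    using assms by (auto simp: valid_graph_def)
  have "0 \<le> weight G i j"
    using assms(3) ij by (auto simp: valid_graph_def)
  then have "weight (tau_k_transform \<tau> k G) i j \<noteq> 0"
    using ij old[of i j] by linarith
  then show ?thesis
    unfolding valid_graph_def using pos sym ij split by blast
qed

section \<open>Community structures of the enlarged graph\<close>

lemma partition_on_Un:
  assumes "partition_on A P" "partition_on B Q" "A \<inter> B = {}"
  shows "partition_on (A \<union> B) (P \<union> Q)"
  using assms by (simp add: partition_on_def disjoint_union)

lemma partition_on_tau_k_map:
  assumes "partition_on (vertices G) C"
  shows "partition_on (vertices (tau_k_transform \<tau> k G)) (tau_k_map k G C)"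
proof -
  have "partition_on (vertices G \<union> {order G + 1..order G + k}) (tau_k_map k G C)"
    unfolding tau_k_map_def
    by (intro partition_on_Un assms partition_on_singletons) (auto simp: vertices_def)
  also have "vertices G \<union> {order G + 1..order G + k} = vertices (tau_k_transform \<tau> k G)"
    unfolding vertices_tau_k_transform by (auto simp: vertices_def)
  finally show ?thesis .
qed

text \<open>Parts of \<open>C\<close> contain only old vertices and the added parts are singletons
  of new ones. The first claim leaves \<open>j\<close> arbitrary; for a new \<open>j\<close> the
  third claim then shows that an old and a new vertex never share a part.\<close>

lemma same_part_tau_k_map:
  assumes "partition_on (vertices G) C"
  shows same_part_tau_k_map_old:
      "i \<in> vertices G \<Longrightarrow> same_part (tau_k_map k G C) i j = same_part C i j"
    and same_part_tau_k_map_new: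
      "i \<in> {order G + 1..order G + k} \<Longrightarrow>
        same_part (tau_k_map k G C) i j = (if i = j then 1 else 0)"
    and same_part_tau_k_map_mixed:
      "j \<in> {order G + 1..order G + k} \<Longrightarrow> same_part C i j = 0"
proof -
  have C: "v \<notin> P" if "P \<in> C" "v \<in> {order G + 1..order G + k}" for P v
  proof -
    have "P \<subseteq> {1..order G}"
      using assms that(1) by (auto simp: partition_on_def vertices_def)
    then show ?thesis
      using that(2) by auto
  qed
  show "i \<in> vertices G \<Longrightarrow> same_part (tau_k_map k G C) i j = same_part C i j"
    by (auto simp: same_part_def tau_k_map_def vertices_def)
  show "i \<in> {order G + 1..order G + k} \<Longrightarrow>
      same_part (tau_k_map k G C) i j = (if i = j then 1 else 0)"
    using C by (auto simp: same_part_def tau_k_map_def simp del: atLeastAtMost_iff)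
  show "j \<in> {order G + 1..order G + k} \<Longrightarrow> same_part C i j = 0"
    using C by (auto simp: same_part_def simp del: atLeastAtMost_iff)
qed

section \<open>Modularity under the (\<tau>,k)-transformation\<close>

lemma modularity_tau_k_transform:
  assumes \<tau>: "0 < \<tau>" and k: "0 < k" and M: "total_weight G \<noteq> 0"
    and C: "partition_on (vertices G) C"
  shows "modularity (tau_k_transform \<tau> k G) (tau_k_map k G C) =
    \<tau> * modularity G C + (1 - \<tau> - (1 - sqrt \<tau>)\<^sup>2 / real k)"
proof -
  let ?G = "tau_k_transform \<tau> k G" and ?N = "{order G + 1..order G + k}"
  \<comment> \<open>Replacing \<tau> by \<open>r^2\<close> turns the identities below into rational
    ones, free of square roots.\<close>
  define r where "r = sqrt \<tau>"
  have r: "\<tau> = r\<^sup>2" "r \<noteq> 0" "sqrt \<tau> = r"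
    using \<tau> by (simp_all add: r_def)
  define B where "B = (\<lambda>i j. weight G i j - deg G i * deg G j / (2 * total_weight G))"
  define B' where "B' = (\<lambda>i j. (weight ?G i j - deg ?G i * deg ?G j / (2 * total_weight ?G)) *
    same_part (tau_k_map k G C) i j)"
  \<comment> \<open>For a new vertex \<open>b\<close> is both the diagonal entry and the degree,
    since its loop is its only edge.\<close>
  define b where "b = 2 * (1 / r - 1) * (1 / r) / real k * total_weight G"
  note tw = total_weight_tau_k_transform[OF \<tau> k]
  \<comment> \<open>In d_i d_j / (2M) numerator and denominator both gain the factor
    \<open>1 / r^2\<close>, which cancels. The new loop sits on the diagonal, where
    \<open>same_part\<close> is 1, and so counts in full.\<close>
  have old: "(\<Sum>j\<in>vertices ?G. B' i j) =
      (\<Sum>j\<in>vertices G. B i j * same_part C i j) + (1 / r - 1) * deg G i"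
    if i: "i \<in> vertices G" for i
  proof -
    have "B' i j = B i j * same_part C i j + (if i = j then (1 / r - 1) * deg G i else 0)"
      if "j \<in> vertices G" for j
      using i that M r(2) same_part_refl[OF C that]
      by (simp add: B'_def B_def weight_tau_k_transform_old deg_tau_k_transform_old tw
          same_part_tau_k_map_old[OF C] r(3)) (simp add: r(1) field_simps power2_eq_square)
    moreover have "B' i j = 0" if "j \<in> ?N" for j
      using i same_part_tau_k_map_mixed[OF C that]
      by (simp add: B'_def same_part_tau_k_map_old[OF C])
    ultimately have "(\<Sum>j\<in>vertices ?G. B' i j) = (\<Sum>j\<in>vertices G.
        B i j * same_part C i j + (if i = j then (1 / r - 1) * deg G i else 0))"
      unfolding sum_vertices_tau_k_transform by simp
    also have "\<dots> = (\<Sum>j\<in>vertices G. B i j * same_part C i j) + (1 / r - 1) * deg G i"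
      using i by (simp add: sum.distrib vertices_def)
    finally show ?thesis .
  qed
  \<comment> \<open>Each new vertex is alone in its part, so its row reduces to the diagonal term;
    the factor \<open>r^2\<close> comes from the new total weight M / \<tau>.\<close>
  have new: "(\<Sum>j\<in>vertices ?G. B' i j) = b - b\<^sup>2 * r\<^sup>2 / (2 * total_weight G)"
    if i: "i \<in> ?N" for i
  proof -
    have "B' i j = (if i = j then b - b\<^sup>2 * r\<^sup>2 / (2 * total_weight G) else 0)" for j
      unfolding B'_def same_part_tau_k_map_new[OF C i] weight_tau_k_transform_new[OF i] tw r(3)
        b_def[symmetric]
      using deg_tau_k_transform_new[OF i, of \<tau>, unfolded r(3), folded b_def]
      by (auto simp: r(1) power2_eq_square)
    then show ?thesis
      using i by (simp add: vertices_tau_k_transform)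
  qed
  have "modularity ?G (tau_k_map k G C) = r\<^sup>2 / (2 * total_weight G) *
      (\<Sum>i\<in>vertices ?G. \<Sum>j\<in>vertices ?G. B' i j)"
    unfolding modularity_def tw B'_def using r(1) by simp
  also have "(\<Sum>i\<in>vertices ?G. \<Sum>j\<in>vertices ?G. B' i j) =
      (\<Sum>i\<in>vertices G. \<Sum>j\<in>vertices G. B i j * same_part C i j) +
      (1 / r - 1) * (2 * total_weight G) + real k * (b - b\<^sup>2 * r\<^sup>2 / (2 * total_weight G))"
    unfolding sum_vertices_tau_k_transform[of "\<lambda>i. \<Sum>j\<in>vertices ?G. B' i j"]
    by (simp add: old new sum.distrib sum_deg flip: sum_distrib_left)
  also have "(\<Sum>i\<in>vertices G. \<Sum>j\<in>vertices G. B i j * same_part C i j) =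
      2 * total_weight G * modularity G C"
    using M by (simp add: modularity_def B_def)
  \<comment> \<open>Put s = 1 / r and \<beta> = s - 1. The loops give \<beta> (1 + s) / s^2 = (s^2 -
    1) / s^2 = 1 - \<open>r^2\<close>, and the quadratic term in \<open>b\<close> gives (\<beta> /
    s)^2 / k with \<beta> / s = 1 - r, which is \<epsilon>.\<close>
  also have "r\<^sup>2 / (2 * total_weight G) * (2 * total_weight G * modularity G C +
      (1 / r - 1) * (2 * total_weight G) + real k * (b - b\<^sup>2 * r\<^sup>2 / (2 * total_weight G))) =
      r\<^sup>2 * modularity G C + (1 - r\<^sup>2 - (1 - r)\<^sup>2 / real k)"
    using k M r(2) unfolding b_def by (simp add: field_simps power2_eq_square)
  finally show ?thesis
    using r by simp
qed

theorem theorem4: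
  fixes \<alpha> \<tau> :: real and k :: nat and G :: wgraph
  assumes "0 < \<alpha>" and "\<alpha> \<le> 1"
    and "0 < \<tau>" and "\<tau> < 1"
    and "0 < k"
    and "valid_graph G"
  shows "let G' = tau_k_transform \<tau> k (alpha_transform \<alpha> G);
             \<epsilon> = (1 - sqrt \<tau>)\<^sup>2 / real k
         in valid_graph G' \<and>
            (\<forall>C. community_structure G C \<longrightarrow>
               (let C' = tau_k_map k (alpha_transform \<alpha> G) (alpha_map C)
                in community_structure G' C' \<and>
                   modularity G' C' = \<tau> * \<alpha> * modularity G C + (1 - \<tau> - \<epsilon>)))"
proof -
  have valid: "valid_graph (alpha_transform \<alpha> G)"
    using assms by (simp add: valid_graph_alpha_transform)
  have M: "total_weight G \<noteq> 0" "total_weight (alpha_transform \<alpha> G) \<noteq> 0"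
    using total_weight_pos[OF assms(6)] total_weight_pos[OF valid] by simp_all
  \<comment> \<open>The intermediate graph has the same vertices, so \<open>C\<close> is a community
    structure of it too, and the results on the (\<tau>,k)-transformation apply with \<alpha> times
    the modularity of \<open>C\<close> in \<open>G\<close> inserted.\<close>
  show ?thesis
    using assms M valid
    by (simp add: Let_def community_structure_def alpha_map_def valid_graph_tau_k_transform
        partition_on_tau_k_map modularity_tau_k_transform modularity_alpha_transform)
qed

end
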